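(* Let $X$ be a set, $E$ a nonempty set of parameters, $N\ge 1$ an integer, and let $(X,\mathcal{T}_i,N,E)$ be a soft $N$-topological space over $X$. If $(X,\mathcal{T}_i,N,E)$ is an $N$-wise soft $T_2$-space, then it is an $N$-wise soft $T_1$-space; and if $(X,\mathcal{T}_i,N,E)$ is an $N$-wise soft $T_1$-space, then it is an $N$-wise soft $T_0$-space.
   Context: A soft set over $X$ (with respect to the fixed nonempty parameter set $E$) is a pair $(F,E)$ where $F:E\to\mathcal{P}(X)$ is any map. The null soft set has $F(e)=\emptyset$ for all $e$; the absolute soft set has $F(e)=X$ for all $e$. Soft unions and soft intersections are defined parameterwise: the soft union of $\{(F_i,E)\}_{i\in I}$ is given by $e\mapsto\bigcup_i F_i(e)$ and the soft intersection of $(F,E)$ and $(G,E)$ by $e\mapsto F(e)\cap G(e)$. A soft topology on $X$ with respect to $E$ is a family $\mathcal{T}$ of soft sets over $X$ that contains the null and the absolute soft sets, and is closed under soft intersections of two members and under arbitrary soft unions. A soft $N$-topological space $(X,\mathcal{T}_i,N,E)$ over $X$ is the set $X$ equipped with $N$ different soft topologies $\mathcal{T}_1,\dots,\mathcal{T}_N$ on $X$ with respect to the same $E$. A soft set is a soft $N$-open set if it belongs to $\mathcal{T}_j$ for some $j\in\{1,\dots,N\}$. For $x\in X$ and $\alpha\in E$, the soft point $(x_\alpha,E)$ is the soft set with value $\{x\}$ at $\alpha$ and $\emptyset$ at every other parameter. It soft belongs to $(F,E)$ iff $x\in F(\alpha)$. Soft points $(x_\alpha,E)$ and $(y_\beta,E)$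 are distinct iff $x\ne y$ or $\alpha\ne\beta$. $(X,\mathcal{T}_i,N,E)$ is: - an $N$-wise soft $T_0$-space if for every pair of distinct soft points over $X$ there is a soft $N$-open set to which exactly one of the two soft points soft belongs; - an $N$-wise soft $T_1$-space if for all distinct soft points $(x_\alpha,E),(y_\beta,E)$ over $X$ (in either order) there is a soft $N$-open set $(A,E)$ such that $(x_\alpha,E)$ soft belongs to $(A,E)$ and $(y_\beta,E)$ does not; - an $N$-wise soft $T_2$-space if for all distinct soft points $(x_\alpha,E),(y_\beta,E)$ over $X$ there are soft $N$-open sets $(A,E),(B,E)$ (possibly from different $\mathcal{T}_j$) such that $(x_\alpha,E)$ soft belongs to $(A,E)$, $(y_\beta,E)$ soft belongs to $(B,E)$, and the soft intersection of $(A,E)$ and $(B,E)$ is the null soft set. *)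

theory Defs
  imports "HOL-Library.FuncSet"
begin

text \<open>A soft set over \<open>X\<close> with parameter set \<open>E\<close> is a map from \<open>E\<close> to the power set of \<open>X\<close>.
  Such maps are represented extensionally (value \<^const>\<open>undefined\<close> outside \<open>E\<close>), so that equality
  of soft sets is equality of the HOL functions.\<close>

type_synonym ('e, 'a) soft_set = "'e \<Rightarrow> 'a set"

definition soft_sets :: "'a set \<Rightarrow> 'e set \<Rightarrow> ('e, 'a) soft_set set" where
  "soft_sets X E = (E \<rightarrow>\<^sub>E Pow X)"

definition null_soft_set :: "'e set \<Rightarrow> ('e, 'a) soft_set" where
  "null_soft_set E = (\<lambda>e\<in>E. {})"

definition absolute_soft_set :: "'a set \<Rightarrow> 'e set \<Rightarrow> ('e, 'a) soft_set" where
  "absolute_soft_set X E = (\<lambda>e\<in>E. X)"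

definition soft_Union :: "'e set \<Rightarrow> ('e, 'a) soft_set set \<Rightarrow> ('e, 'a) soft_set" where
  "soft_Union E \<F> = (\<lambda>e\<in>E. \<Union>F\<in>\<F>. F e)"

definition soft_inter ::
    "'e set \<Rightarrow> ('e, 'a) soft_set \<Rightarrow> ('e, 'a) soft_set \<Rightarrow> ('e, 'a) soft_set" where
  "soft_inter E F G = (\<lambda>e\<in>E. F e \<inter> G e)"

definition soft_topology :: "'a set \<Rightarrow> 'e set \<Rightarrow> ('e, 'a) soft_set set \<Rightarrow> bool" where
  "soft_topology X E T \<longleftrightarrow>
     T \<subseteq> soft_sets X E \<and>
     null_soft_set E \<in> T \<and>
     absolute_soft_set X E \<in> T \<and>
     (\<forall>F\<in>T. \<forall>G\<in>T. soft_inter E F G \<in> T) \<and>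
     (\<forall>\<F>. \<F> \<subseteq> T \<longrightarrow> soft_Union E \<F> \<in> T)"

text \<open>The family of topologies is indexed by \<open>{1..N}\<close>; its values elsewhere are irrelevant.
  Injectivity says that the \<open>N\<close> soft topologies are different.\<close>

definition soft_N_topological_space ::
    "'a set \<Rightarrow> (nat \<Rightarrow> ('e, 'a) soft_set set) \<Rightarrow> nat \<Rightarrow> 'e set \<Rightarrow> bool" where
  "soft_N_topological_space X T N E \<longleftrightarrow>
     (\<forall>i\<in>{1..N}. soft_topology X E (T i)) \<and> inj_on T {1..N}"

definition soft_N_open ::
    "(nat \<Rightarrow> ('e, 'a) soft_set set) \<Rightarrow> nat \<Rightarrow> ('e, 'a) soft_set \<Rightarrow> bool" where
  "soft_N_open T N A \<longleftrightarrow> (\<exists>j\<in>{1..N}. A \<in> T j)"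

definition soft_point :: "'e set \<Rightarrow> 'a \<Rightarrow> 'e \<Rightarrow> ('e, 'a) soft_set" where
  "soft_point E x \<alpha> = (\<lambda>e\<in>E. if e = \<alpha> then {x} else {})"

definition soft_points :: "'a set \<Rightarrow> 'e set \<Rightarrow> ('e, 'a) soft_set set" where
  "soft_points X E = {soft_point E x \<alpha> | x \<alpha>. x \<in> X \<and> \<alpha> \<in> E}"

lemma soft_point_eq_iff:
  assumes "\<alpha> \<in> E" "\<beta> \<in> E"
  shows "soft_point E x \<alpha> = soft_point E y \<beta> \<longleftrightarrow> x = y \<and> \<alpha> = \<beta>"
proof
  assume "soft_point E x \<alpha> = soft_point E y \<beta>"
  then have "soft_point E x \<alpha> \<alpha> = soft_point E y \<beta> \<alpha>"
    by simp
  then show "x = y \<and> \<alpha> = \<beta>"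
    using assms by (auto simp: soft_point_def split: if_splits)
qed simp

text \<open>By the previous lemma a soft point determines its underlying \<open>x\<close> and \<open>\<alpha>\<close>, so the
  existential quantifiers below merely read them off.\<close>

definition soft_belongs :: "'e set \<Rightarrow> ('e, 'a) soft_set \<Rightarrow> ('e, 'a) soft_set \<Rightarrow> bool" where
  "soft_belongs E P F \<longleftrightarrow> (\<exists>x. \<exists>\<alpha>\<in>E. P = soft_point E x \<alpha> \<and> x \<in> F \<alpha>)"

lemma soft_belongs_soft_point:
  assumes "\<alpha> \<in> E"
  shows "soft_belongs E (soft_point E x \<alpha>) F \<longleftrightarrow> x \<in> F \<alpha>"
  using assms by (auto simp: soft_belongs_def soft_point_eq_iff)

definition N_wise_soft_T0 ::
    "'a set \<Rightarrow> (nat \<Rightarrow> ('e, 'a) soft_set set) \<Rightarrow> nat \<Rightarrow> 'e set \<Rightarrow> bool" where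
  "N_wise_soft_T0 X T N E \<longleftrightarrow>
     (\<forall>P\<in>soft_points X E. \<forall>Q\<in>soft_points X E. P \<noteq> Q \<longrightarrow>
        (\<exists>A. soft_N_open T N A \<and>
             (soft_belongs E P A \<and> \<not> soft_belongs E Q A \<or>
              soft_belongs E Q A \<and> \<not> soft_belongs E P A)))"

definition N_wise_soft_T1 ::
    "'a set \<Rightarrow> (nat \<Rightarrow> ('e, 'a) soft_set set) \<Rightarrow> nat \<Rightarrow> 'e set \<Rightarrow> bool" where
  "N_wise_soft_T1 X T N E \<longleftrightarrow>
     (\<forall>P\<in>soft_points X E. \<forall>Q\<in>soft_points X E. P \<noteq> Q \<longrightarrow>
        (\<exists>A. soft_N_open T N A \<and> soft_belongs E P A \<and> \<not> soft_belongs E Q A))"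

definition N_wise_soft_T2 ::
    "'a set \<Rightarrow> (nat \<Rightarrow> ('e, 'a) soft_set set) \<Rightarrow> nat \<Rightarrow> 'e set \<Rightarrow> bool" where
  "N_wise_soft_T2 X T N E \<longleftrightarrow>
     (\<forall>P\<in>soft_points X E. \<forall>Q\<in>soft_points X E. P \<noteq> Q \<longrightarrow>
        (\<exists>A B. soft_N_open T N A \<and> soft_N_open T N B \<and>
               soft_belongs E P A \<and> soft_belongs E Q B \<and>
               soft_inter E A B = null_soft_set E))"

end

theory Submission
  imports Defs
begin

text \<open>A soft point carries a single element at a single parameter, so soft belonging to a soft set
  is ordinary membership at that parameter, and a soft point cannot lie in two soft sets whose
  parameterwise intersection is null. Hence, of two soft open sets separating \<open>P\<close> and \<open>Q\<close> in the
  sense of \<open>T\<^sub>2\<close>, the one around \<open>P\<close> already misses \<open>Q\<close>, which is \<open>T\<^sub>1\<close>. The step from \<open>T\<^sub>1\<close> to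
  \<open>T\<^sub>0\<close> merely forgets which of the two points is the one that is contained.\<close>

lemma not_soft_belongs_both_if_soft_inter_null:
  assumes "soft_inter E A B = null_soft_set E" and "soft_belongs E Q B"
  shows "\<not> soft_belongs E Q A"
proof
  assume "soft_belongs E Q A"
  from assms(2) obtain y \<beta> where \<beta>: "\<beta> \<in> E" and Q: "Q = soft_point E y \<beta>" and yB: "y \<in> B \<beta>"
    unfolding soft_belongs_def by blast
  from \<open>soft_belongs E Q A\<close> have "y \<in> A \<beta>"
    by (simp add: Q soft_belongs_soft_point[OF \<beta>])
  with yB have "y \<in> soft_inter E A B \<beta>"
    using \<beta> by (simp add: soft_inter_def)
  then show False
    using \<beta> by (simp add: assms(1) null_soft_set_def)
qed

lemma N_wise_soft_T2_imp_T1: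
  assumes "N_wise_soft_T2 X T N E"
  shows "N_wise_soft_T1 X T N E"
  using assms unfolding N_wise_soft_T2_def N_wise_soft_T1_def
  by (meson not_soft_belongs_both_if_soft_inter_null)

lemma N_wise_soft_T1_imp_T0:
  assumes "N_wise_soft_T1 X T N E"
  shows "N_wise_soft_T0 X T N E"
  using assms unfolding N_wise_soft_T1_def N_wise_soft_T0_def by meson

theorem proposition4p7:
  fixes X :: "'a set" and E :: "'e set" and N :: nat
    and T :: "nat \<Rightarrow> ('e, 'a) soft_set set"
  assumes "E \<noteq> {}"
    and "N \<ge> 1"
    and "soft_N_topological_space X T N E"
  shows "(N_wise_soft_T2 X T N E \<longrightarrow> N_wise_soft_T1 X T N E) \<and>
         (N_wise_soft_T1 X T N E \<longrightarrow> N_wise_soft_T0 X T N E)"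
  by (simp add: N_wise_soft_T2_imp_T1 N_wise_soft_T1_imp_T0)

end
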